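(* Let $a>0$ and $0\le t<T$ be fixed. Then there exist $y_1<r-a\sqrt{\gamma(t)}$ and $y_2>r+a\sqrt{\gamma(t)}$ such that the robust optimal feedback function $\hat\pi(t,\cdot)$ satisfies: $\hat\pi(t,y)<0$ for $y<y_1$; $\hat\pi(t,y)>0$ for $y_1<y<r$; $\hat\pi(t,y)<0$ for $r<y<y_2$; $\hat\pi(t,y)>0$ for $y>y_2$; and $\hat\pi(t,y)=0$ for $y\in\{y_1,r,y_2\}$.
   Context: Constants: $T>0$, $\sigma>0$, $\sigma_0>0$, $k>0$, $r\in\mathbb{R}$. $\gamma(t)=(\sigma_0^{-2}+t\sigma^{-2})^{-1}$ for $t\in[0,T]$. The feedback function is $$\hat\pi(t,y)=\frac{e^{-r(T-t)}}{k\sigma^2}\times\begin{cases}f_y(t,y)\gamma(t)+y-a\sqrt{\gamma(t)}-r,& r<y-a\sqrt{\gamma(t)},\\ f_y(t,y)\gamma(t),& y-a\sqrt{\gamma(t)}\le r\le y+a\sqrt{\gamma(t)},\\ f_y(t,y)\gamma(t)+y+a\sqrt{\gamma(t)}-r,& r>y+a\sqrt{\gamma(t)},\end{cases}$$ where $f\in C^{1,2}([0,T)\times\mathbb{R})\cap C([0,T]\times\mathbb{R})$ is the unique solution, satisfying $\max_{0\le t\le T}|f(t,y)|\le C_1(1+y^2)$ for all $y\in\mathbb{R}$ and some constant $C_1>0$, of $$f_t+\frac12 f_{yy}\frac{\gamma^2(t)}{\sigma^2}+f_y\frac{\gamma(t)(r-y)}{\sigma^2}-\Big[\frac{(r-y+a\sqrt{\gamma(t)})^2}{2\sigma^2}I_{\{r-y+a\sqrt{\gamma(t)}\le0\}}+\frac{(r-y-a\sqrt{\gamma(t)})^2}{2\sigma^2}I_{\{r-y-a\sqrt{\gamma(t)}\ge0\}}\Big]=0$$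 on $[0,T)\times\mathbb{R}$ with $f(T,y)=0$ for $y\in\mathbb{R}$. Subscripts denote partial derivatives; $I_{\{\cdot\}}$ is the indicator. *)

theory Defs
  imports "HOL-Analysis.Analysis"
begin

definition post_var :: "real \<Rightarrow> real \<Rightarrow> real \<Rightarrow> real" where
  "post_var \<sigma> \<sigma>0 t = 1 / (1 / \<sigma>0\<^sup>2 + t / \<sigma>\<^sup>2)"

text \<open>
  Partial derivatives of \<open>f\<close> as a function of \<open>(t, y)\<close>. The time derivative is taken within
  \<open>[0,T)\<close>, hence it is the right derivative at \<open>t = 0\<close>.
\<close>

definition D_t :: "real \<Rightarrow> (real \<Rightarrow> real \<Rightarrow> real) \<Rightarrow> real \<Rightarrow> real \<Rightarrow> real" where
  "D_t T f t y = vector_derivative (\<lambda>s. f s y) (at t within {0..<T})"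

definition D_y :: "(real \<Rightarrow> real \<Rightarrow> real) \<Rightarrow> real \<Rightarrow> real \<Rightarrow> real" where
  "D_y f t y = deriv (\<lambda>x. f t x) y"

definition C12 :: "real \<Rightarrow> (real \<Rightarrow> real \<Rightarrow> real) \<Rightarrow> bool" where
  "C12 T f \<longleftrightarrow>
     (\<forall>t\<in>{0..<T}. \<forall>y.
        (\<lambda>s. f s y) differentiable (at t within {0..<T}) \<and>
        (\<lambda>x. f t x) differentiable (at y) \<and>
        (\<lambda>x. D_y f t x) differentiable (at y)) \<and>
     continuous_on ({0..<T} \<times> UNIV) (\<lambda>(t, y). f t y) \<and>
     continuous_on ({0..<T} \<times> UNIV) (\<lambda>(t, y). D_t T f t y) \<and>
     continuous_on ({0..<T} \<times> UNIV) (\<lambda>(t, y). D_y f t y) \<and>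
     continuous_on ({0..<T} \<times> UNIV) (\<lambda>(t, y). D_y (D_y f) t y)"

definition pde_solution ::
  "real \<Rightarrow> real \<Rightarrow> real \<Rightarrow> real \<Rightarrow> real \<Rightarrow> (real \<Rightarrow> real \<Rightarrow> real) \<Rightarrow> bool" where
  "pde_solution T \<sigma> \<sigma>0 r a f \<longleftrightarrow>
     C12 T f \<and>
     continuous_on ({0..T} \<times> UNIV) (\<lambda>(t, y). f t y) \<and>
     (\<exists>C>0. \<forall>y. \<forall>t\<in>{0..T}. \<bar>f t y\<bar> \<le> C * (1 + y\<^sup>2)) \<and>
     (\<forall>t\<in>{0..<T}. \<forall>y.
        let \<gamma> = post_var \<sigma> \<sigma>0 t in
        D_t T f t y + 1 / 2 * D_y (D_y f) t y * (\<gamma>\<^sup>2 / \<sigma>\<^sup>2)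
          + D_y f t y * (\<gamma> * (r - y) / \<sigma>\<^sup>2)
          - ((r - y + a * sqrt \<gamma>)\<^sup>2 / (2 * \<sigma>\<^sup>2) * of_bool (r - y + a * sqrt \<gamma> \<le> 0)
             + (r - y - a * sqrt \<gamma>)\<^sup>2 / (2 * \<sigma>\<^sup>2) * of_bool (r - y - a * sqrt \<gamma> \<ge> 0)) = 0) \<and>
     (\<forall>y. f T y = 0)"

definition robust_feedback ::
  "real \<Rightarrow> real \<Rightarrow> real \<Rightarrow> real \<Rightarrow> real \<Rightarrow> real \<Rightarrow> (real \<Rightarrow> real \<Rightarrow> real) \<Rightarrow> real \<Rightarrow> real \<Rightarrow> real" where
  "robust_feedback T \<sigma> \<sigma>0 k r a f t y =
     (let \<gamma> = post_var \<sigma> \<sigma>0 t in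
      exp (- r * (T - t)) / (k * \<sigma>\<^sup>2) *
      (if r < y - a * sqrt \<gamma> then D_y f t y * \<gamma> + y - a * sqrt \<gamma> - r
       else if r \<le> y + a * sqrt \<gamma> then D_y f t y * \<gamma>
       else D_y f t y * \<gamma> + y + a * sqrt \<gamma> - r))"

end

theory Submission
  imports Defs
begin

text \<open>
  In the coordinate \<open>z = (y - r) / \<gamma>(t)\<close> the drift disappears: \<open>v(t, z) = f(t, r + \<gamma>(t) z)\<close> satisfies
  \<open>v\<^sub>t + \<kappa> v\<^sub>z\<^sub>z = H\<close> with \<open>\<kappa> = 1 / (2 \<sigma>\<^sup>2)\<close>, where \<open>H\<close> is \<open>\<kappa> \<gamma>\<^sup>2\<close> times the squared distance of \<open>z\<close> to
  \<open>[-b, b]\<close>, \<open>b = a / sqrt \<gamma>\<close>. Moreover \<open>v\<^sub>z = \<gamma> f\<^sub>y\<close>. Because the equation is invariant under translations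
  and reflections, the maximum principle applies to differences of translates of \<open>v\<close>, which avoids
  differentiating the equation: \<open>v\<close> is even, it is strictly decreasing in \<open>z > 0\<close> with \<open>v\<^sub>z < 0\<close>, and,
  as \<open>H\<^sub>z\<^sub>z \<le> 2 \<kappa> \<gamma>\<^sup>2\<close>, one has \<open>v\<^sub>z\<^sub>z \<ge> - (\<gamma>(t) - \<gamma>(T))\<close>. Hence \<open>v\<^sub>z + \<gamma> z\<close> has slope at least
  \<open>\<gamma>(T) > 0\<close>; it is below \<open>a sqrt \<gamma>\<close> at \<open>z = b\<close>, so it crosses this level exactly once, at a
  point beyond \<open>b\<close>, and this crossing is the outer zero of the feedback.
\<close>

section \<open>The maximum principle for the backward heat equation\<close>

text \<open>At the maximum \<open>u'\<close> vanishes, so \<open>d > 0\<close> would make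
  \<open>u'\<close> positive just to the right of \<open>z\<close>, and the mean value theorem would
  give a larger value of \<open>u\<close> there.\<close>

lemma second_derivative_local_max:
  fixes u u' :: "real \<Rightarrow> real"
  assumes der: "\<And>x. (u has_real_derivative u' x) (at x)"
    and der2: "(u' has_real_derivative d) (at z)"
    and "e > 0" and max: "\<And>x. \<bar>z - x\<bar> < e \<Longrightarrow> u x \<le> u z"
  shows "d \<le> 0"
proof (rule ccontr)
  assume "\<not> d \<le> 0"
  have "u' z = 0"
    using DERIV_local_max[OF der \<open>e > 0\<close>] max by blast
  obtain \<delta> where \<delta>: "\<delta> > 0" "\<And>h. 0 < h \<Longrightarrow> h < \<delta> \<Longrightarrow> u' z < u' (z + h)"
    using has_real_derivative_pos_inc_right[OF der2] \<open>\<not> d \<le> 0\<close> by auto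
  define h where "h = min \<delta> e / 2"
  have h: "0 < h" "h < \<delta>" "h < e"
    using \<open>e > 0\<close> \<delta>(1) by (auto simp: h_def)
  obtain \<xi> where \<xi>: "z < \<xi>" "\<xi> < z + h" "u (z + h) - u z = (z + h - z) * u' \<xi>"
    using MVT2[of z "z + h" u u'] der h by auto
  have "u' \<xi> > 0"
    using \<delta>(2)[of "\<xi> - z"] \<xi> h \<open>u' z = 0\<close> by auto
  then have "(z + h - z) * u' \<xi> > 0"
    using h by simp
  then have "u (z + h) > u z"
    using \<xi>(3) by linarith
  then show False
    using max[of "z + h"] h by simp
qed

text \<open>
  \<open>has_heat_op \<kappa> J w s z c\<close> says that \<open>w\<^sub>t + \<kappa> w\<^sub>z\<^sub>z = c\<close> at \<open>(s, z)\<close>, with the time derivative taken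
  within \<open>J\<close>. For \<open>J = {t0..<t1}\<close> the equation runs backwards in time: data are given at \<open>t1\<close>.
\<close>

definition has_heat_op ::
  "real \<Rightarrow> real set \<Rightarrow> (real \<Rightarrow> real \<Rightarrow> real) \<Rightarrow> real \<Rightarrow> real \<Rightarrow> real \<Rightarrow> bool" where
  "has_heat_op \<kappa> J w s z c \<longleftrightarrow>
     (\<exists>w' wt wzz. ((\<lambda>s. w s z) has_real_derivative wt) (at s within J) \<and>
        (\<forall>x. (w s has_real_derivative w' x) (at x)) \<and>
        (w' has_real_derivative wzz) (at z) \<and> wt + \<kappa> * wzz = c)"

section \<open>Linearity and symmetries of the heat operator\<close>

lemma has_heat_opI:
  assumes "((\<lambda>s. w s z) has_real_derivative wt) (at s within J)"
    and "\<And>x. (w s has_real_derivative w' x) (at x)"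
    and "(w' has_real_derivative wzz) (at z)"
    and "wt + \<kappa> * wzz = c"
  shows "has_heat_op \<kappa> J w s z c"
  using assms unfolding has_heat_op_def by blast

lemma has_heat_op_subset:
  "has_heat_op \<kappa> J w s z c \<Longrightarrow> I \<subseteq> J \<Longrightarrow> has_heat_op \<kappa> I w s z c"
  unfolding has_heat_op_def using has_field_derivative_subset[of _ _ s J I] by fast

lemma has_heat_op_add:
  assumes "has_heat_op \<kappa> J v s z b" "has_heat_op \<kappa> J w s z c"
  shows "has_heat_op \<kappa> J (\<lambda>s x. v s x + w s x) s z (b + c)"
proof -
  obtain v' vt vzz w' wt wzz where
    "((\<lambda>s. v s z) has_real_derivative vt) (at s within J)"
    "\<And>x. (v s has_real_derivative v' x) (at x)"
    "(v' has_real_derivative vzz) (at z)" "vt + \<kappa> * vzz = b"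
    "((\<lambda>s. w s z) has_real_derivative wt) (at s within J)"
    "\<And>x. (w s has_real_derivative w' x) (at x)"
    "(w' has_real_derivative wzz) (at z)" "wt + \<kappa> * wzz = c"
    using assms unfolding has_heat_op_def by metis
  then show ?thesis
    by (intro has_heat_opI[where w' = "\<lambda>x. v' x + w' x" and wt = "vt + wt" and wzz = "vzz + wzz"])
      (auto intro!: derivative_intros simp: algebra_simps)
qed

lemma has_heat_op_cmult:
  assumes "has_heat_op \<kappa> J w s z c"
  shows "has_heat_op \<kappa> J (\<lambda>s x. a * w s x) s z (a * c)"
proof -
  obtain w' wt wzz where
    "((\<lambda>s. w s z) has_real_derivative wt) (at s within J)"
    "\<And>x. (w s has_real_derivative w' x) (at x)"
    "(w' has_real_derivative wzz) (at z)" "wt + \<kappa> * wzz = c"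
    using assms unfolding has_heat_op_def by metis
  then show ?thesis
    by (intro has_heat_opI[where w' = "\<lambda>x. a * w' x" and wt = "a * wt" and wzz = "a * wzz"])
      (auto intro!: DERIV_cmult simp: algebra_simps)
qed

lemma has_heat_op_diff:
  assumes "has_heat_op \<kappa> J v s z b" "has_heat_op \<kappa> J w s z c"
  shows "has_heat_op \<kappa> J (\<lambda>s x. v s x - w s x) s z (b - c)"
  using has_heat_op_add[OF assms(1) has_heat_op_cmult[OF assms(2), of "-1"]] by simp

lemma has_heat_op_shift:
  assumes "has_heat_op \<kappa> J w s (z + \<delta>) c"
  shows "has_heat_op \<kappa> J (\<lambda>s x. w s (x + \<delta>)) s z c"
proof -
  obtain w' wt wzz where
    w: "((\<lambda>s. w s (z + \<delta>)) has_real_derivative wt) (at s within J)"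
    "\<And>x. (w s has_real_derivative w' x) (at x)"
    "(w' has_real_derivative wzz) (at (z + \<delta>))" "wt + \<kappa> * wzz = c"
    using assms unfolding has_heat_op_def by metis
  then have "((\<lambda>x. w s (x + \<delta>)) has_real_derivative w' (x + \<delta>)) (at x)" for x
    using DERIV_shift by blast
  then show ?thesis
    using w by (intro has_heat_opI[where w' = "\<lambda>x. w' (x + \<delta>)" and wt = wt and wzz = wzz])
      (simp_all add: DERIV_shift)
qed

lemma has_heat_op_reflect:
  assumes "has_heat_op \<kappa> J w s (- z) c"
  shows "has_heat_op \<kappa> J (\<lambda>s x. w s (- x)) s z c"
proof -
  obtain w' wt wzz where
    w: "((\<lambda>s. w s (- z)) has_real_derivative wt) (at s within J)"
    "\<And>x. (w s has_real_derivative w' x) (at x)"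
    "(w' has_real_derivative wzz) (at (- z))" "wt + \<kappa> * wzz = c"
    using assms unfolding has_heat_op_def by metis
  have "((\<lambda>x. - w' (- x)) has_real_derivative wzz) (at z)"
    using w(3) DERIV_minus[of "\<lambda>x. w' (- x)" "- wzz" z]
    by (auto simp: DERIV_mirror)
  moreover have "((\<lambda>x. w s (- x)) has_real_derivative - w' (- x)) (at x)" for x
    using w(2)[of "- x"] DERIV_mirror[of "w s" "w' (- x)" x] by simp
  ultimately show ?thesis
    using w by (intro has_heat_opI[where w' = "\<lambda>x. - w' (- x)" and wt = wt and wzz = wzz]) auto
qed

section \<open>The maximum principle under quadratic growth\<close>

lemma has_heat_op_local_max:
  assumes "has_heat_op \<kappa> {t0..<t1} w s z c" and "\<kappa> > 0" and "t0 \<le> s" "s < t1" and "e > 0"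
    and max_t: "\<And>s'. s \<le> s' \<Longrightarrow> s' < t1 \<Longrightarrow> w s' z \<le> w s z"
    and max_z: "\<And>x. \<bar>z - x\<bar> < e \<Longrightarrow> w s x \<le> w s z"
  shows "c \<le> 0"
proof -
  obtain w' wt wzz where
    w: "((\<lambda>s. w s z) has_real_derivative wt) (at s within {t0..<t1})"
    "\<And>x. (w s has_real_derivative w' x) (at x)"
    "(w' has_real_derivative wzz) (at z)" "wt + \<kappa> * wzz = c"
    using assms(1) unfolding has_heat_op_def by metis
  have "wzz \<le> 0"
    by (rule second_derivative_local_max[OF w(2,3) \<open>e > 0\<close> max_z])
  \<comment> \<open>Only later times enter, so the one-sided derivative at \<open>s = t0\<close> is
    treated like any other. This is the direction in which the maximum is assumed.\<close>
  moreover have "wt \<le> 0"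
  proof (rule ccontr)
    assume "\<not> wt \<le> 0"
    then obtain d where d: "d > 0"
      "\<And>h. 0 < h \<Longrightarrow> s + h \<in> {t0..<t1} \<Longrightarrow> h < d \<Longrightarrow> w s z < w (s + h) z"
      using has_real_derivative_pos_inc_right[OF w(1)] by auto
    define h where "h = min d (t1 - s) / 2"
    have "0 < h" "h < d" "h < t1 - s"
      using d(1) \<open>s < t1\<close> by (auto simp: h_def)
    then show False
      using d(2)[of h] max_t[of "s + h"] \<open>t0 \<le> s\<close> by auto
  qed
  ultimately show ?thesis
    using w(4) \<open>\<kappa> > 0\<close> by (smt (verit) mult_nonneg_nonneg mult_minus_right)
qed

text \<open>The decay rate \<open>12 * \<kappa>\<close> pays for the diffusion of the quartic,
  because \<open>z\<^sup>2 < 1 + z ^ 4\<close>. Quartic growth is chosen to dominate the quadratic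
  growth of the functions to be compared.\<close>

lemma heat_barrier:
  fixes \<kappa> s z t1 :: real
  assumes "\<kappa> > 0"
  shows "\<exists>c<0. has_heat_op \<kappa> J (\<lambda>s x. exp (12 * \<kappa> * (t1 - s)) * (1 + x ^ 4)) s z c"
proof -
  let ?E = "exp (12 * \<kappa> * (t1 - s))"
  have "has_heat_op \<kappa> J (\<lambda>s x. exp (12 * \<kappa> * (t1 - s)) * (1 + x ^ 4)) s z
      (?E * (- 12 * \<kappa>) * (1 + z ^ 4) + \<kappa> * (?E * (12 * z\<^sup>2)))"
    by (rule has_heat_opI[where w' = "\<lambda>x. ?E * (4 * x ^ 3)"])
      (auto intro!: derivative_eq_intros simp: power2_eq_square)
  moreover have "?E * (- 12 * \<kappa>) * (1 + z ^ 4) + \<kappa> * (?E * (12 * z\<^sup>2))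
      = - (12 * \<kappa> * ?E * ((z\<^sup>2 - 1/2)\<^sup>2 + 3/4))"
    by (simp add: algebra_simps power2_eq_square power4_eq_xxxx)
  moreover have "12 * \<kappa> * ?E * ((z\<^sup>2 - 1/2)\<^sup>2 + 3/4) > 0"
    using assms by (intro mult_pos_pos add_nonneg_pos) auto
  ultimately show ?thesis
    by (metis neg_less_0_iff_less)
qed

text \<open>Subtracting a small multiple of the barrier confines positive values to a compact set
  and makes the operator strictly positive, which is impossible at a positive maximum.
  \<open>S = UNIV\<close> covers the Cauchy problem; half-lines and intervals bring in lateral
  boundary values.\<close>

proposition heat_maximum_principle:
  fixes w :: "real \<Rightarrow> real \<Rightarrow> real"
  assumes "\<kappa> > 0" and "closed S"
    and cont: "continuous_on ({t0..t1} \<times> S) (\<lambda>(s, z). w s z)"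
    and growth: "\<And>s z. s \<in> {t0..t1} \<Longrightarrow> z \<in> S \<Longrightarrow> w s z \<le> C * (1 + z\<^sup>2)"
    and terminal: "\<And>z. z \<in> S \<Longrightarrow> w t1 z \<le> 0"
    and boundary: "\<And>s z. s \<in> {t0..<t1} \<Longrightarrow> z \<in> S \<Longrightarrow> z \<notin> interior S \<Longrightarrow> w s z \<le> 0"
    and super: "\<And>s z. s \<in> {t0..<t1} \<Longrightarrow> z \<in> interior S \<Longrightarrow>
      \<exists>c\<ge>0. has_heat_op \<kappa> {t0..<t1} w s z c"
    and "s0 \<in> {t0..t1}" "z0 \<in> S"
  shows "w s0 z0 \<le> 0"
proof (rule ccontr)
  assume "\<not> w s0 z0 \<le> 0"
  define \<psi> where "\<psi> = (\<lambda>s x. exp (12 * \<kappa> * (t1 - s)) * (1 + x ^ 4))"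
  \<comment> \<open>With this choice \<open>u s0 z0\<close> is half of \<open>w s0 z0\<close>, hence
    still positive.\<close>
  define \<epsilon> where "\<epsilon> = w s0 z0 / (2 * \<psi> s0 z0)"
  define u where "u = (\<lambda>s x. w s x - \<epsilon> * \<psi> s x)"
  have \<psi>_pos: "\<psi> s x > 0" for s x
    unfolding \<psi>_def by (intro mult_pos_pos add_pos_nonneg) auto
  have "\<epsilon> > 0"
    using \<open>\<not> w s0 z0 \<le> 0\<close> \<psi>_pos by (simp add: \<epsilon>_def)
  have u0: "u s0 z0 > 0"
    using \<open>\<not> w s0 z0 \<le> 0\<close> \<psi>_pos[of s0 z0] by (simp add: u_def \<epsilon>_def)
  \<comment> \<open>For \<open>\<bar>x\<bar> \<ge> R\<close> the quartic barrier, scaled by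
    \<epsilon>, beats the growth bound; the last entry places the point \<open>(s0, z0)\<close> in
    the compact set.\<close>
  define R where "R = Max {1, 2 * \<bar>C\<bar> / \<epsilon>, \<bar>z0\<bar>}"
  have R: "R \<ge> 1" "R \<ge> 2 * \<bar>C\<bar> / \<epsilon>" "R \<ge> \<bar>z0\<bar>"
    by (simp_all add: R_def)
  have u_neg: "u s x \<le> 0" if "s \<in> {t0..t1}" "x \<in> S" "\<bar>x\<bar> \<ge> R" for s x
  proof -
    have "\<bar>x\<bar> \<ge> 1" using that R by simp
    then have "x\<^sup>2 \<ge> \<bar>x\<bar>"
      by (metis abs_ge_zero mult_left_mono mult.right_neutral power2_abs power2_eq_square)
    then have x2: "x\<^sup>2 \<ge> 1" "x\<^sup>2 \<ge> 2 * \<bar>C\<bar> / \<epsilon>"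
      using that R by linarith+
    have "2 * \<bar>C\<bar> \<le> \<epsilon> * x\<^sup>2"
      using x2(2) \<open>\<epsilon> > 0\<close> by (simp add: field_simps)
    have "C * (1 + x\<^sup>2) \<le> \<bar>C\<bar> * (2 * x\<^sup>2)"
      using x2(1) by (intro mult_mono) auto
    also have "\<dots> \<le> \<epsilon> * x\<^sup>2 * x\<^sup>2"
      using mult_right_mono[OF \<open>2 * \<bar>C\<bar> \<le> \<epsilon> * x\<^sup>2\<close>, of "x\<^sup>2"] by (simp add: algebra_simps)
    also have "\<dots> \<le> \<epsilon> * (1 * (1 + x ^ 4))"
      using \<open>\<epsilon> > 0\<close> by (simp add: algebra_simps power2_eq_square power4_eq_xxxx)
    also have "\<dots> \<le> \<epsilon> * \<psi> s x"
      unfolding \<psi>_def using that(1) \<open>\<epsilon> > 0\<close> \<open>\<kappa> > 0\<close>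
      by (intro mult_left_mono mult_right_mono) auto
    finally show ?thesis
      using growth[OF that(1,2)] by (simp add: u_def)
  qed
  define K where "K = {t0..t1} \<times> (S \<inter> {-R..R})"
  have "compact K"
    unfolding K_def using \<open>closed S\<close> by (intro compact_Times) (auto intro: closed_Int_compact)
  moreover have "(s0, z0) \<in> K"
    using assms(8,9) R by (auto simp: K_def)
  moreover have "continuous_on K (\<lambda>(s, z). u s z)"
    unfolding u_def \<psi>_def K_def case_prod_beta
    by (intro continuous_intros continuous_on_subset[OF cont[unfolded case_prod_beta]]) auto
  ultimately obtain s z where sz: "(s, z) \<in> K" and max: "\<And>s' x. (s', x) \<in> K \<Longrightarrow> u s' x \<le> u s z"
    using continuous_attains_sup[of K "\<lambda>(s, z). u s z"] by fastforce
  then have u_pos: "u s z > 0"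
    using u0 \<open>(s0, z0) \<in> K\<close> by fastforce
  then have w_pos: "w s z > 0"
    using mult_pos_pos[OF \<open>\<epsilon> > 0\<close> \<psi>_pos[of s z]] by (simp add: u_def)
  have "s \<in> {t0..t1}" "z \<in> S" using sz by (auto simp: K_def)
  then have s: "s \<in> {t0..<t1}"
    using terminal[of z] w_pos by (cases "s = t1") auto
  have z: "z \<in> interior S"
    using boundary[OF s \<open>z \<in> S\<close>] w_pos by force
  \<comment> \<open>Since \<open>u\<close> is nonpositive beyond \<open>R\<close> and positive at
    \<open>(s, z)\<close>, the maximum over \<open>K\<close> is a maximum over the whole domain, so
    all neighbours of \<open>z\<close> in \<open>S\<close> may be compared.\<close>
  have max': "u s' x \<le> u s z" if "s' \<in> {t0..t1}" "x \<in> S" for s' x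
    using that max[of s' x] u_neg[OF that] u_pos by (cases "\<bar>x\<bar> \<ge> R") (auto simp: K_def abs_if split: if_splits)
  obtain e where e: "e > 0" "ball z e \<subseteq> S"
    using z by (meson mem_interior)
  obtain c where c: "c \<ge> 0" "has_heat_op \<kappa> {t0..<t1} w s z c"
    using super[OF s z] by blast
  obtain d where d: "d < 0" "has_heat_op \<kappa> {t0..<t1} \<psi> s z d"
    unfolding \<psi>_def using heat_barrier[OF \<open>\<kappa> > 0\<close>] by blast
  have st: "t0 \<le> s" "s < t1"
    using s by auto
  have "has_heat_op \<kappa> {t0..<t1} u s z (c - \<epsilon> * d)"
    unfolding u_def by (intro has_heat_op_diff has_heat_op_cmult c d)
  then have "c - \<epsilon> * d \<le> 0"
    using \<open>\<kappa> > 0\<close> st e(1)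
  proof (rule has_heat_op_local_max)
    show "u s' z \<le> u s z" if "s \<le> s'" "s' < t1" for s'
      using that s \<open>z \<in> S\<close> by (intro max') auto
    show "u s x \<le> u s z" if "\<bar>z - x\<bar> < e" for x
      using that s e(2) by (intro max') (auto simp: dist_real_def)
  qed
  then show False
    using c(1) d(1) \<open>\<epsilon> > 0\<close> mult_pos_neg[of \<epsilon> d] by simp
qed

section \<open>The transformed equation\<close>

definition sq_excess :: "real \<Rightarrow> real \<Rightarrow> real" where
  "sq_excess b z = (max 0 (\<bar>z\<bar> - b))\<^sup>2"

lemma sq_excess_minus [simp]: "sq_excess b (- z) = sq_excess b z"
  by (simp add: sq_excess_def)

lemma sq_excess_mono: "\<bar>x\<bar> \<le> \<bar>y\<bar> \<Longrightarrow> sq_excess b x \<le> sq_excess b y"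
  unfolding sq_excess_def by (intro power_mono) auto

text \<open>Every point of \<open>[-b, b]\<close> is a competitor for the nearest one. Thus
  \<open>sq_excess b\<close> is a minimum of translated parabolas, and its differences are estimated
  through a single parabola.\<close>

lemma sq_excess_le: "\<bar>p\<bar> \<le> b \<Longrightarrow> sq_excess b z \<le> (z - p)\<^sup>2"
  using power_mono[of "max 0 (\<bar>z\<bar> - b)" "\<bar>z - p\<bar>" 2] by (simp add: sq_excess_def)

text \<open>\<open>sq_excess b z\<close> is the squared distance of \<open>z\<close> to \<open>[-b, b]\<close>; \<open>p\<close> is the nearest point.\<close>

lemma sq_excess_attained:
  assumes "b \<ge> 0"
  obtains p where "\<bar>p\<bar> \<le> b" "sq_excess b z = (z - p)\<^sup>2"
proof (cases "\<bar>z\<bar> \<le> b")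
  case True
  then show ?thesis
    using that[of z] by (simp add: sq_excess_def)
next
  case False
  then have "sq_excess b z = (z - sgn z * b)\<^sup>2"
    using assms by (auto simp: sq_excess_def sgn_if abs_if power2_eq_square algebra_simps)
  moreover have "\<bar>sgn z * b\<bar> \<le> b"
    using assms by (auto simp: sgn_if)
  ultimately show ?thesis
    using that by blast
qed

text \<open>The point nearest to \<open>z + \<delta>\<close> is used as competitor at
  \<open>z\<close>, which leaves the increment of one parabola. The bound is stated with
  \<open>B\<close> so that it can be uniform over thresholds that vary in time.\<close>

lemma sq_excess_increment:
  assumes "0 \<le> b" "b \<le> B" "\<delta> \<ge> 0"
  shows "sq_excess b (z + \<delta>) - sq_excess b z \<ge> \<delta> * (2 * z + \<delta> - 2 * B)"
proof -
  obtain p where p: "\<bar>p\<bar> \<le> b" "sq_excess b (z + \<delta>) = (z + \<delta> - p)\<^sup>2"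
    using sq_excess_attained[OF assms(1)] by metis
  have "\<delta> * (2 * z + \<delta> - 2 * B) \<le> \<delta> * (2 * z + \<delta> - 2 * p)"
    using p(1) assms by (intro mult_left_mono) auto
  also have "\<dots> = (z + \<delta> - p)\<^sup>2 - (z - p)\<^sup>2"
    by (simp add: power2_eq_square algebra_simps)
  finally show ?thesis
    using sq_excess_le[OF p(1), of z] p(2) by linarith
qed

text \<open>Semiconcavity of a minimum of parabolas: the point nearest to \<open>z\<close> is used
  as competitor at both \<open>z + \<delta>\<close> and \<open>z - \<delta>\<close>.\<close>

lemma sq_excess_second_difference:
  assumes "b \<ge> 0"
  shows "sq_excess b (z + \<delta>) + sq_excess b (z - \<delta>) - 2 * sq_excess b z \<le> 2 * \<delta>\<^sup>2"
proof -
  obtain p where p: "\<bar>p\<bar> \<le> b" "sq_excess b z = (z - p)\<^sup>2"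
    using sq_excess_attained[OF assms] by metis
  have "(z + \<delta> - p)\<^sup>2 + (z - \<delta> - p)\<^sup>2 - 2 * (z - p)\<^sup>2 = 2 * \<delta>\<^sup>2"
    by (simp add: power2_eq_square algebra_simps)
  then show ?thesis
    using sq_excess_le[OF p(1), of "z + \<delta>"] sq_excess_le[OF p(1), of "z - \<delta>"] p(2) by linarith
qed

text \<open>These are the facts that the change of variables delivers. With
  \<open>\<kappa> = 1 / (2 * \<sigma>\<^sup>2)\<close> the assumption \<open>\<gamma>_deriv\<close>
  is the Riccati equation of the posterior variance.\<close>

locale heat_form =
  fixes \<kappa> T a C :: real and \<gamma> :: "real \<Rightarrow> real" and v :: "real \<Rightarrow> real \<Rightarrow> real"
  assumes \<kappa>_pos: "\<kappa> > 0" and a_pos: "a > 0" and T_pos: "T > 0"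
    and \<gamma>_pos: "\<And>s. s \<in> {0..T} \<Longrightarrow> \<gamma> s > 0"
    and \<gamma>_deriv: "\<And>s. s \<in> {0..<T} \<Longrightarrow>
      (\<gamma> has_real_derivative - 2 * \<kappa> * (\<gamma> s)\<^sup>2) (at s within {0..<T})"
    and \<gamma>_decreasing: "\<And>s s'. 0 \<le> s \<Longrightarrow> s < s' \<Longrightarrow> s' \<le> T \<Longrightarrow> \<gamma> s' < \<gamma> s"
    and \<gamma>_cont: "continuous_on {0..T} \<gamma>"
    and v_cont: "continuous_on ({0..T} \<times> UNIV) (\<lambda>(s, z). v s z)"
    and v_growth: "\<And>s z. s \<in> {0..T} \<Longrightarrow> \<bar>v s z\<bar> \<le> C * (1 + z\<^sup>2)"
    and v_heat: "\<And>s z. s \<in> {0..<T} \<Longrightarrow>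
      has_heat_op \<kappa> {0..<T} v s z (\<kappa> * (\<gamma> s)\<^sup>2 * sq_excess (a / sqrt (\<gamma> s)) z)"
    and v_terminal: "\<And>z. v T z = 0"
begin

text \<open>
  Since \<open>A' = - \<kappa> \<gamma>\<^sup>2\<close>, the heat operator maps \<open>A(t) z\<^sup>2\<close> to \<open>- \<kappa> \<gamma>\<^sup>2 z\<^sup>2\<close> plus a function of time; so
  \<open>A\<close> converts quadratic estimates of the source into estimates of \<open>v\<close>.
\<close>

definition A :: "real \<Rightarrow> real" where "A s = (\<gamma> s - \<gamma> T) / 2"

text \<open>The thresholds \<open>a / sqrt (\<gamma> s)\<close> grow as \<gamma> decreases; this is
  their value at the terminal time.\<close>

definition B :: real where "B = a / sqrt (\<gamma> T)"

lemma A_nonneg: "s \<in> {0..T} \<Longrightarrow> A s \<ge> 0"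
  using \<gamma>_decreasing[of s T] by (cases "s = T") (auto simp: A_def)

lemma A_pos: "s \<in> {0..<T} \<Longrightarrow> A s > 0"
  using \<gamma>_decreasing[of s T] by (auto simp: A_def)

lemma A_antimono: "0 \<le> s \<Longrightarrow> s \<le> s' \<Longrightarrow> s' \<le> T \<Longrightarrow> A s' \<le> A s"
  using \<gamma>_decreasing[of s s'] by (cases "s = s'") (auto simp: A_def)

lemma A_cont: "continuous_on {0..T} A"
  unfolding A_def[abs_def] by (intro continuous_intros \<gamma>_cont) auto

lemma A_deriv:
  "s \<in> {0..<T} \<Longrightarrow> (A has_real_derivative - \<kappa> * (\<gamma> s)\<^sup>2) (at s within {0..<T})"
  unfolding A_def[abs_def] by (auto intro!: derivative_eq_intros \<gamma>_deriv)

lemma B_pos: "B > 0"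
  using a_pos T_pos \<gamma>_pos[of T] by (simp add: B_def)

lemma threshold_bounds:
  assumes "s \<in> {0..T}"
  shows "0 \<le> a / sqrt (\<gamma> s)" "a / sqrt (\<gamma> s) \<le> B"
proof -
  show "0 \<le> a / sqrt (\<gamma> s)"
    using a_pos \<gamma>_pos[OF assms] by simp
  have "\<gamma> T \<le> \<gamma> s"
    using A_nonneg[OF assms] by (simp add: A_def)
  then show "a / sqrt (\<gamma> s) \<le> B"
    unfolding B_def using a_pos \<gamma>_pos[OF assms] \<gamma>_pos[of T] T_pos
    by (intro divide_left_mono mult_pos_pos) auto
qed

lemma source_le:
  assumes "s \<in> {0..T}" "e \<le> e'"
  shows "\<kappa> * (\<gamma> s)\<^sup>2 * e \<le> \<kappa> * (\<gamma> s)\<^sup>2 * e'"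
  using assms \<kappa>_pos by (intro mult_left_mono) auto

section \<open>Comparison of \<open>v\<close> with its translates and reflection\<close>

lemma v_cont_compose:
  assumes "continuous_on X g" "continuous_on X h" "g ` X \<subseteq> {0..T}"
  shows "continuous_on X (\<lambda>p. v (g p) (h p))"
  using continuous_on_compose2[OF v_cont, of X "\<lambda>p. (g p, h p)"] assms
  by (auto intro!: continuous_intros)

lemma C_nonneg: "C \<ge> 0"
  using v_growth[of 0 0] T_pos by (simp add: order_trans[OF abs_ge_zero])

text \<open>For fixed \<delta> this is the growth condition that the maximum principle requires of a
  translate of \<open>v\<close>.\<close>

lemma v_growth_shift:
  assumes "s \<in> {0..T}"
  shows "\<bar>v s (z + \<delta>)\<bar> \<le> C * (2 + 2 * \<delta>\<^sup>2) * (1 + z\<^sup>2)"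
proof -
  have "(2 + 2 * \<delta>\<^sup>2) * (1 + z\<^sup>2) - (1 + (z + \<delta>)\<^sup>2) = 1 + (z - \<delta>)\<^sup>2 + 2 * (\<delta> * z)\<^sup>2"
    by (simp add: power2_eq_square algebra_simps)
  also have "\<dots> \<ge> 0" by simp
  finally have "C * (1 + (z + \<delta>)\<^sup>2) \<le> C * ((2 + 2 * \<delta>\<^sup>2) * (1 + z\<^sup>2))"
    using C_nonneg by (intro mult_left_mono) auto
  then show ?thesis
    using v_growth[OF assms, of "z + \<delta>"] by (simp add: mult.assoc)
qed

text \<open>The source is even in \<open>z\<close>, so the difference of \<open>v\<close> and its
  reflection solves the homogeneous equation with zero terminal data. One inequality at
  \<open>z\<close> and at \<open>- z\<close> gives equality.\<close>

lemma v_even: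
  assumes "s \<in> {0..T}"
  shows "v s (- z) = v s z"
proof -
  have "v s z - v s (- z) \<le> 0" for z
  proof (rule heat_maximum_principle[where w = "\<lambda>s z. v s z - v s (- z)" and S = UNIV
        and C = "2 * C" and ?t0.0 = 0 and ?t1.0 = T and \<kappa> = \<kappa>])
    show "continuous_on ({0..T} \<times> UNIV) (\<lambda>(s, z). v s z - v s (- z))"
      unfolding case_prod_beta by (intro continuous_intros v_cont_compose) auto
    show "v s z - v s (- z) \<le> 2 * C * (1 + z\<^sup>2)" if "s \<in> {0..T}" for s z
      using v_growth[OF that, of z] v_growth[OF that, of "- z"] by simp
    show "\<exists>c\<ge>0. has_heat_op \<kappa> {0..<T} (\<lambda>s z. v s z - v s (- z)) s z c" if "s \<in> {0..<T}" for s z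
      using has_heat_op_diff[OF v_heat[OF that, of z] has_heat_op_reflect[OF v_heat[OF that, of "- z"]]]
      by auto
  qed (use assms \<kappa>_pos v_terminal in auto)
  from this[of z] this[of "- z"] show ?thesis by simp
qed

text \<open>At \<open>z = - \<delta> / 2\<close> the points \<open>z\<close> and
  \<open>z + \<delta>\<close> are mirror images, so evenness supplies a zero boundary value. To the
  right of it \<open>z + \<delta>\<close> is farther from the origin, and there the source is at
  least as large.\<close>

lemma v_increment_nonneg:
  assumes "s \<in> {0..T}" "\<delta> \<ge> 0" "z \<ge> - \<delta> / 2"
  shows "v s (z + \<delta>) - v s z \<le> 0"
proof (rule heat_maximum_principle[where w = "\<lambda>s z. v s (z + \<delta>) - v s z" and S = "{- \<delta> / 2..}"
      and C = "C * (2 + 2 * \<delta>\<^sup>2) + C" and ?t0.0 = 0 and ?t1.0 = T and \<kappa> = \<kappa>])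
  show "continuous_on ({0..T} \<times> {- \<delta> / 2..}) (\<lambda>(s, z). v s (z + \<delta>) - v s z)"
    unfolding case_prod_beta by (intro continuous_intros v_cont_compose) auto
  show "v s (z + \<delta>) - v s z \<le> (C * (2 + 2 * \<delta>\<^sup>2) + C) * (1 + z\<^sup>2)" if "s \<in> {0..T}" for s z
    using v_growth[OF that, of z] v_growth_shift[OF that, of z \<delta>] by (simp add: distrib_right)
  show "v s (z + \<delta>) - v s z \<le> 0"
    if "s \<in> {0..<T}" "z \<in> {- \<delta> / 2..}" "z \<notin> interior {- \<delta> / 2..}" for s z
  proof -
    have "z = - (\<delta> / 2)" using that by auto
    then show ?thesis using v_even[of s "\<delta> / 2"] that(1) by simp
  qed
  show "\<exists>c\<ge>0. has_heat_op \<kappa> {0..<T} (\<lambda>s z. v s (z + \<delta>) - v s z) s z c"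
    if "s \<in> {0..<T}" "z \<in> interior {- \<delta> / 2..}" for s z
  proof (intro exI conjI)
    show "has_heat_op \<kappa> {0..<T} (\<lambda>s z. v s (z + \<delta>) - v s z) s z
      (\<kappa> * (\<gamma> s)\<^sup>2 * sq_excess (a / sqrt (\<gamma> s)) (z + \<delta>) - \<kappa> * (\<gamma> s)\<^sup>2 * sq_excess (a / sqrt (\<gamma> s)) z)"
      by (rule has_heat_op_diff[OF has_heat_op_shift[OF v_heat] v_heat]) (rule that(1))+
    have "\<bar>z\<bar> \<le> \<bar>z + \<delta>\<bar>" using that(2) \<open>\<delta> \<ge> 0\<close> by auto
    then show "0 \<le> \<kappa> * (\<gamma> s)\<^sup>2 * sq_excess (a / sqrt (\<gamma> s)) (z + \<delta>)
        - \<kappa> * (\<gamma> s)\<^sup>2 * sq_excess (a / sqrt (\<gamma> s)) z"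
      using source_le[OF _ sq_excess_mono] that(1) by simp
  qed
qed (use assms \<kappa>_pos v_terminal in auto)

text \<open>The comparison function is \<open>A\<close> times a function affine in \<open>z\<close>,
  so only the time derivative of \<open>A\<close> contributes; it is matched by
  \<open>sq_excess_increment\<close>. The result is informative beyond \<open>B\<close>, where it
  forces \<open>v\<close> to decrease strictly.\<close>

lemma v_decrement_linear_bound:
  assumes "s \<in> {0..T}" "\<delta> \<ge> 0"
  shows "v s z - v s (z + \<delta>) \<ge> A s * (\<delta> * (2 * z + \<delta> - 2 * B))"
proof -
  define w where "w = (\<lambda>s z. A s * (\<delta> * (2 * z + \<delta> - 2 * B)) - (v s z - v s (z + \<delta>)))"
  have "w s z \<le> 0"
  proof (rule heat_maximum_principle[where w = w and S = UNIV
        and C = "A 0 * (\<delta> * (1 + \<delta>)) + (C + C * (2 + 2 * \<delta>\<^sup>2))"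
        and ?t0.0 = 0 and ?t1.0 = T and \<kappa> = \<kappa>])
    show "continuous_on ({0..T} \<times> UNIV) (\<lambda>(s, z). w s z)"
      unfolding case_prod_beta w_def
      by (intro continuous_intros v_cont_compose continuous_on_compose2[OF A_cont]) auto
    show "w s z \<le> (A 0 * (\<delta> * (1 + \<delta>)) + (C + C * (2 + 2 * \<delta>\<^sup>2))) * (1 + z\<^sup>2)"
      if "s \<in> {0..T}" for s z
    proof -
      have "2 * z \<le> 1 + z\<^sup>2"
        using zero_le_power2[of "z - 1"] by (simp add: power2_diff)
      moreover have "\<delta> \<le> \<delta> * (1 + z\<^sup>2)"
        using \<open>\<delta> \<ge> 0\<close> by (simp add: mult_le_cancel_left1)
      ultimately have "2 * z + \<delta> - 2 * B \<le> 1 + z\<^sup>2 + \<delta> * (1 + z\<^sup>2)"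
        using B_pos by linarith
      then have "\<delta> * (2 * z + \<delta> - 2 * B) \<le> \<delta> * (1 + \<delta>) * (1 + z\<^sup>2)"
        using \<open>\<delta> \<ge> 0\<close> mult_left_mono[of "2 * z + \<delta> - 2 * B" "1 + z\<^sup>2 + \<delta> * (1 + z\<^sup>2)" \<delta>]
        by (simp add: algebra_simps)
      then have "A s * (\<delta> * (2 * z + \<delta> - 2 * B)) \<le> A s * (\<delta> * (1 + \<delta>) * (1 + z\<^sup>2))"
        using A_nonneg[OF that] by (rule mult_left_mono)
      also have "\<dots> \<le> A 0 * (\<delta> * (1 + \<delta>) * (1 + z\<^sup>2))"
        using A_antimono[of 0 s] that \<open>\<delta> \<ge> 0\<close> by (intro mult_right_mono) auto
      finally show ?thesis
        using v_growth[OF that, of z] v_growth_shift[OF that, of z \<delta>]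
        unfolding w_def by (simp add: distrib_right mult.assoc)
    qed
    show "\<exists>c\<ge>0. has_heat_op \<kappa> {0..<T} w s z c" if "s \<in> {0..<T}" for s z
    proof (intro exI conjI)
      let ?b = "a / sqrt (\<gamma> s)"
      have "has_heat_op \<kappa> {0..<T} (\<lambda>s z. A s * (\<delta> * (2 * z + \<delta> - 2 * B))) s z
          (- \<kappa> * (\<gamma> s)\<^sup>2 * (\<delta> * (2 * z + \<delta> - 2 * B)))"
        using that by (intro has_heat_opI[where w' = "\<lambda>x. A s * (\<delta> * 2)" and wzz = 0])
          (auto intro!: derivative_eq_intros A_deriv)
      then show "has_heat_op \<kappa> {0..<T} w s z
          (- \<kappa> * (\<gamma> s)\<^sup>2 * (\<delta> * (2 * z + \<delta> - 2 * B))
            - (\<kappa> * (\<gamma> s)\<^sup>2 * sq_excess ?b z - \<kappa> * (\<gamma> s)\<^sup>2 * sq_excess ?b (z + \<delta>)))"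
        unfolding w_def
        by (rule has_heat_op_diff[OF _ has_heat_op_diff[OF v_heat[OF that] has_heat_op_shift[OF v_heat[OF that]]]])
      have s: "s \<in> {0..T}" using that by auto
      show "0 \<le> - \<kappa> * (\<gamma> s)\<^sup>2 * (\<delta> * (2 * z + \<delta> - 2 * B))
            - (\<kappa> * (\<gamma> s)\<^sup>2 * sq_excess ?b z - \<kappa> * (\<gamma> s)\<^sup>2 * sq_excess ?b (z + \<delta>))"
        using source_le[OF s sq_excess_increment[OF threshold_bounds[OF s] \<open>\<delta> \<ge> 0\<close>, of z]]
        by (simp add: right_diff_distrib)
    qed
  qed (use assms \<kappa>_pos v_terminal in \<open>auto simp: w_def A_def\<close>)
  then show ?thesis by (simp add: w_def)
qed

lemma v_second_difference_bound:
  assumes "s \<in> {0..T}"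
  shows "v s (z + \<delta>) + v s (z - \<delta>) - 2 * v s z \<ge> - (2 * A s * \<delta>\<^sup>2)"
proof -
  define w where "w = (\<lambda>s z. 2 * v s z - v s (z + \<delta>) - v s (z + (- \<delta>)) - A s * (2 * \<delta>\<^sup>2))"
  have "w s z \<le> 0"
  proof (rule heat_maximum_principle[where w = w and S = UNIV
        and C = "2 * C + C * (2 + 2 * \<delta>\<^sup>2) + C * (2 + 2 * \<delta>\<^sup>2)"
        and ?t0.0 = 0 and ?t1.0 = T and \<kappa> = \<kappa>])
    show "continuous_on ({0..T} \<times> UNIV) (\<lambda>(s, z). w s z)"
      unfolding case_prod_beta w_def
      by (intro continuous_intros v_cont_compose continuous_on_compose2[OF A_cont]) auto
    show "w s z \<le> (2 * C + C * (2 + 2 * \<delta>\<^sup>2) + C * (2 + 2 * \<delta>\<^sup>2)) * (1 + z\<^sup>2)"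
      if "s \<in> {0..T}" for s z
      using v_growth[OF that, of z] v_growth_shift[OF that, of z \<delta>]
        v_growth_shift[OF that, of z "- \<delta>"] mult_nonneg_nonneg[OF A_nonneg[OF that], of "2 * \<delta>\<^sup>2"]
      unfolding w_def by (simp add: distrib_right)
    show "\<exists>c\<ge>0. has_heat_op \<kappa> {0..<T} w s z c" if "s \<in> {0..<T}" for s z
    proof (intro exI conjI)
      let ?b = "a / sqrt (\<gamma> s)"
      let ?H = "\<lambda>z. \<kappa> * (\<gamma> s)\<^sup>2 * sq_excess ?b z"
      have "has_heat_op \<kappa> {0..<T} (\<lambda>s z. A s * (2 * \<delta>\<^sup>2)) s z (- \<kappa> * (\<gamma> s)\<^sup>2 * (2 * \<delta>\<^sup>2))"
        using that by (intro has_heat_opI[where w' = "\<lambda>x. 0" and wzz = 0])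
          (auto intro!: derivative_eq_intros A_deriv)
      then show "has_heat_op \<kappa> {0..<T} w s z
          (2 * ?H z - ?H (z + \<delta>) - ?H (z + (- \<delta>)) - (- \<kappa> * (\<gamma> s)\<^sup>2 * (2 * \<delta>\<^sup>2)))"
        unfolding w_def
        by (rule has_heat_op_diff[OF has_heat_op_diff[OF has_heat_op_diff[OF
              has_heat_op_cmult[OF v_heat[OF that]] has_heat_op_shift[OF v_heat[OF that]]]
              has_heat_op_shift[OF v_heat[OF that]]]])
      have s: "s \<in> {0..T}" using that by auto
      show "0 \<le> 2 * ?H z - ?H (z + \<delta>) - ?H (z + (- \<delta>)) - (- \<kappa> * (\<gamma> s)\<^sup>2 * (2 * \<delta>\<^sup>2))"
        using source_le[OF s sq_excess_second_difference[OF threshold_bounds(1)[OF s], of z \<delta>]]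
        by (simp add: algebra_simps)
    qed
  qed (use assms \<kappa>_pos v_terminal in \<open>auto simp: w_def A_def\<close>)
  then show ?thesis by (simp add: w_def)
qed

text \<open>
  The barrier \<open>exp (p z - \<kappa> p\<^sup>2 (s - t)) - 1\<close> solves the heat equation, and for the chosen \<open>p\<close> it is
  nonpositive at time \<open>t1\<close> on all of \<open>[0, B + 1]\<close>, yet positive at time \<open>t\<close> for every \<open>z > 0\<close>.
  The bound is linear in \<open>\<delta>\<close>, so it survives division by \<open>\<delta>\<close>.
\<close>

lemma v_strict_decrement:
  assumes "t \<in> {0..<T}"
  shows "\<exists>c>0. \<exists>p>0. \<forall>z\<in>{0..B + 1}. \<forall>\<delta>\<ge>0. v t z - v t (z + \<delta>) \<ge> \<delta> * c * (exp (p * z) - 1)"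
proof -
  \<comment> \<open>Stopping strictly before \<open>T\<close> keeps \<open>A t1\<close>
    positive.\<close>
  define t1 where "t1 = (t + T) / 2"
  \<comment> \<open>This solves \<open>\<kappa> * p * (t1 - t) = B + 1\<close>, so the exponent of
    the barrier at time \<open>t1\<close> is \<open>p * (z - (B + 1))\<close>.\<close>
  define p where "p = (B + 1) / (\<kappa> * (t1 - t))"
  \<comment> \<open>At \<open>z = B + 1\<close> the exponential is at most
    \<open>exp (p * (B + 1))\<close>, so the barrier stays below \<open>2 * \<delta> * A t1\<close>;
    the linear bound supplies this, since its affine factor is \<open>2 + \<delta>\<close>
    there.\<close>
  define c where "c = 2 * A t1 * exp (- p * (B + 1))"
  have t1: "t < t1" "t1 < T" "0 \<le> t"
    using assms by (auto simp: t1_def field_simps)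
  have "p > 0"
    using t1 B_pos \<kappa>_pos by (simp add: p_def)
  have "c > 0"
    using t1 A_pos[of t1] by (simp add: c_def)
  have "v t z - v t (z + \<delta>) \<ge> \<delta> * c * (exp (p * z) - 1)" if "z \<in> {0..B + 1}" "\<delta> \<ge> 0" for z \<delta>
  proof -
    define \<phi> where "\<phi> = (\<lambda>s z. exp (p * z - \<kappa> * p\<^sup>2 * (s - t)) - 1)"
    define w where "w = (\<lambda>s z. \<delta> * c * \<phi> s z - (v s z - v s (z + \<delta>)))"
    have \<phi>_le: "\<phi> s z \<le> exp (p * z)" if "t \<le> s" for s z
      using that \<kappa>_pos by (simp add: \<phi>_def order_trans[of _ "exp (p * z - \<kappa> * p\<^sup>2 * (s - t))"])
    have v_dec: "v s z - v s (z + \<delta>) \<ge> 0" if "s \<in> {t..t1}" "z \<ge> 0" for s z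
      using v_increment_nonneg[of s \<delta> z] that t1 \<open>\<delta> \<ge> 0\<close> by auto
    have dc: "\<delta> * c \<ge> 0"
      using \<open>\<delta> \<ge> 0\<close> \<open>c > 0\<close> by simp
    have "w t z \<le> 0"
    proof (rule heat_maximum_principle[where w = w and S = "{0..B + 1}"
          and C = "\<delta> * c * exp (p * (B + 1))" and ?t0.0 = t and ?t1.0 = t1 and \<kappa> = \<kappa>])
      show "continuous_on ({t..t1} \<times> {0..B + 1}) (\<lambda>(s, z). w s z)"
        unfolding case_prod_beta w_def \<phi>_def
        using t1 by (intro continuous_intros v_cont_compose) auto
      show "w s z \<le> \<delta> * c * exp (p * (B + 1)) * (1 + z\<^sup>2)" if "s \<in> {t..t1}" "z \<in> {0..B + 1}" for s z
      proof -
        have "exp (p * z) \<le> exp (p * (B + 1))"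
          using that \<open>p > 0\<close> by simp
        then have "\<phi> s z \<le> exp (p * (B + 1))"
          using \<phi>_le[of s z] that by (auto intro: order_trans)
        then have "\<delta> * c * \<phi> s z \<le> \<delta> * c * exp (p * (B + 1)) * 1"
          using dc mult_left_mono by fastforce
        also have "\<dots> \<le> \<delta> * c * exp (p * (B + 1)) * (1 + z\<^sup>2)"
          using dc by (intro mult_left_mono) auto
        finally show ?thesis
          using v_dec[of s z] that by (simp add: w_def)
      qed
      show "w t1 z \<le> 0" if "z \<in> {0..B + 1}" for z
      proof -
        have "\<kappa> * p\<^sup>2 * (t1 - t) = p * (B + 1)"
          using t1 \<kappa>_pos by (simp add: p_def power2_eq_square)
        moreover have "p * z \<le> p * (B + 1)"
          using that \<open>p > 0\<close> by simp
        ultimately have "\<phi> t1 z \<le> 0"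
          by (simp add: \<phi>_def)
        then have "\<delta> * c * \<phi> t1 z \<le> 0"
          using dc by (rule mult_nonneg_nonpos[rotated])
        then show ?thesis
          using v_dec[of t1 z] that t1 by (simp add: w_def)
      qed
      show "w s z \<le> 0"
        if "s \<in> {t..<t1}" and z: "z \<in> {0..B + 1}" "z \<notin> interior {0..B + 1}" for s z
      proof -
        consider "z = 0" | "z = B + 1"
          using z by fastforce
        then show ?thesis
        proof cases
          case 1
          have "\<phi> s 0 \<le> 0"
            using that \<kappa>_pos by (simp add: \<phi>_def)
          then have "\<delta> * c * \<phi> s 0 \<le> 0"
            using dc by (rule mult_nonneg_nonpos[rotated])
          then show ?thesis
            using v_dec[of s 0] that 1 by (simp add: w_def)
        next
          case 2
          have "\<delta> * c * \<phi> s z \<le> \<delta> * c * exp (p * (B + 1))"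
            using dc \<phi>_le[of s z] that 2 by (intro mult_left_mono) auto
          also have "\<dots> = A t1 * (\<delta> * 2) * (exp (- p * (B + 1)) * exp (p * (B + 1)))"
            by (simp add: c_def)
          also have "\<dots> = A t1 * (\<delta> * 2)"
            by (simp flip: exp_add)
          also have "\<dots> \<le> A s * (\<delta> * (2 * (B + 1) + \<delta> - 2 * B))"
            using A_antimono[of s t1] A_nonneg[of t1] that t1 \<open>\<delta> \<ge> 0\<close> by (intro mult_mono) auto
          also have "\<dots> \<le> v s z - v s (z + \<delta>)"
            using v_decrement_linear_bound[of s \<delta> z] that t1 \<open>\<delta> \<ge> 0\<close> 2 by auto
          finally show ?thesis by (simp add: w_def)
        qed
      qed
      show "\<exists>c\<ge>0. has_heat_op \<kappa> {t..<t1} w s z c"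
        if s: "s \<in> {t..<t1}" and z: "z \<in> interior {0..B + 1}" for s z
      proof (intro exI conjI)
        let ?b = "a / sqrt (\<gamma> s)"
        have sT: "s \<in> {0..<T}" using s t1 by auto
        have "has_heat_op \<kappa> {t..<t1} \<phi> s z 0"
          unfolding \<phi>_def
          by (rule has_heat_opI[where w' = "\<lambda>x. p * exp (p * x - \<kappa> * p\<^sup>2 * (s - t))"])
            (auto intro!: derivative_eq_intros simp: power2_eq_square)
        moreover have "has_heat_op \<kappa> {t..<t1} (\<lambda>s z. v s z - v s (z + \<delta>)) s z
            (\<kappa> * (\<gamma> s)\<^sup>2 * sq_excess ?b z - \<kappa> * (\<gamma> s)\<^sup>2 * sq_excess ?b (z + \<delta>))"
          by (rule has_heat_op_subset[OF has_heat_op_diff[OF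
                v_heat[OF sT] has_heat_op_shift[OF v_heat[OF sT]]]]) (use t1 in auto)
        ultimately show "has_heat_op \<kappa> {t..<t1} w s z (\<delta> * c * 0
            - (\<kappa> * (\<gamma> s)\<^sup>2 * sq_excess ?b z - \<kappa> * (\<gamma> s)\<^sup>2 * sq_excess ?b (z + \<delta>)))"
          unfolding w_def by (rule has_heat_op_diff[OF has_heat_op_cmult])
        have "z \<ge> 0" using z by auto
        then have "\<bar>z\<bar> \<le> \<bar>z + \<delta>\<bar>" using \<open>\<delta> \<ge> 0\<close> by simp
        then show "0 \<le> \<delta> * c * 0
            - (\<kappa> * (\<gamma> s)\<^sup>2 * sq_excess ?b z - \<kappa> * (\<gamma> s)\<^sup>2 * sq_excess ?b (z + \<delta>))"
          using source_le[OF _ sq_excess_mono] sT by simp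
      qed
    qed (use that(1) t1(1) \<kappa>_pos in simp_all)
    then show ?thesis by (simp add: w_def \<phi>_def)
  qed
  then show ?thesis
    using \<open>c > 0\<close> \<open>p > 0\<close> by blast
qed

section \<open>The gradient of \<open>v\<close> at a fixed time\<close>

context
  fixes t :: real and g :: "real \<Rightarrow> real"
  assumes t: "t \<in> {0..<T}"
    and v_deriv: "\<And>z. (v t has_real_derivative g z) (at z)"
begin

lemma gradient_odd: "g (- z) = - g z"
proof -
  have "((\<lambda>x. v t (- x)) has_real_derivative - g (- z)) (at z)"
    using v_deriv[of "- z"] by (simp add: DERIV_mirror)
  moreover have "(\<lambda>x. v t (- x)) = v t"
    using v_even t by auto
  ultimately show ?thesis
    using DERIV_unique[OF v_deriv] by fastforce
qed

text \<open>A decrement estimate linear in \<delta> passes to the derivative: if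
  \<open>g z + m\<close> were positive, \<open>v t x + m * x\<close> would increase just to the
  right of \<open>z\<close>, against the estimate.\<close>

lemma gradient_le:
  assumes "\<And>\<delta>. \<delta> \<ge> 0 \<Longrightarrow> v t z - v t (z + \<delta>) \<ge> \<delta> * m"
  shows "g z \<le> - m"
proof (rule ccontr)
  assume "\<not> g z \<le> - m"
  moreover have "((\<lambda>x. v t x + m * x) has_real_derivative g z + m) (at z)"
    by (auto intro!: derivative_eq_intros v_deriv)
  ultimately obtain d where d: "d > 0"
    "\<And>h. 0 < h \<Longrightarrow> h < d \<Longrightarrow> v t z + m * z < v t (z + h) + m * (z + h)"
    using has_real_derivative_pos_inc_right[of "\<lambda>x. v t x + m * x" "g z + m" z UNIV] by auto
  show False
    using d(1) d(2)[of "d / 2"] assms[of "d / 2"] by (simp add: algebra_simps)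
qed

text \<open>Up to \<open>B + 1\<close> the exponential barrier gives a strict bound, and beyond it
  the linear bound does.\<close>

lemma gradient_neg:
  assumes "z > 0"
  shows "g z < 0"
proof (cases "z \<le> B + 1")
  case True
  obtain c p where cp: "c > 0" "p > 0"
    and le: "\<And>z \<delta>. z \<in> {0..B + 1} \<Longrightarrow> \<delta> \<ge> 0 \<Longrightarrow> \<delta> * c * (exp (p * z) - 1) \<le> v t z - v t (z + \<delta>)"
    using v_strict_decrement[OF t] by metis
  have "g z \<le> - (c * (exp (p * z) - 1))"
    using le[of z] True assms by (intro gradient_le) (auto simp: mult.assoc)
  moreover have "c * (exp (p * z) - 1) > 0"
    using cp assms by (intro mult_pos_pos) auto
  ultimately show ?thesis by simp
next
  case False
  have "g z \<le> - (A t * (2 * z - 2 * B))"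
  proof (rule gradient_le)
    fix \<delta> :: real assume "\<delta> \<ge> 0"
    have "\<delta> * (A t * (2 * z - 2 * B)) \<le> A t * (\<delta> * (2 * z + \<delta> - 2 * B))"
      using \<open>\<delta> \<ge> 0\<close> A_pos[OF t] by (simp add: algebra_simps)
    also have "\<dots> \<le> v t z - v t (z + \<delta>)"
      using v_decrement_linear_bound[of t \<delta> z] t \<open>\<delta> \<ge> 0\<close> by simp
    finally show "\<delta> * (A t * (2 * z - 2 * B)) \<le> v t z - v t (z + \<delta>)" .
  qed
  moreover have "A t * (2 * z - 2 * B) > 0"
    using False A_pos[OF t] by (intro mult_pos_pos) auto
  ultimately show ?thesis by simp
qed

text \<open>The function \<open>q\<close> of the step \<delta> is nonpositive and vanishes at zero,
  so it has a maximum there. Its second derivative at zero is \<open>- 2 * d - 4 * A t\<close>, and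
  the second derivative test yields the bound.\<close>

lemma gradient_deriv_ge: "\<exists>d \<ge> - 2 * A t. (g has_real_derivative d) (at z)"
proof -
  obtain g' wt d where w: "\<And>x. (v t has_real_derivative g' x) (at x)"
    "(g' has_real_derivative d) (at z)"
    using v_heat[OF t, of z] unfolding has_heat_op_def by blast
  have "g' = g"
    using DERIV_unique[OF w(1) v_deriv] by auto
  then have d: "(g has_real_derivative d) (at z)"
    using w(2) by simp
  define q where "q = (\<lambda>\<delta>. 2 * v t z - v t (z + \<delta>) - v t (z - \<delta>) - 2 * A t * \<delta>\<^sup>2)"
  have "- 2 * d - 4 * A t \<le> 0"
  proof (rule second_derivative_local_max[where u = q and e = 1 and z = 0])
    show "(q has_real_derivative g (z - x) - g (z + x) - 4 * A t * x) (at x)" for x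
      unfolding q_def
      by (auto intro!: derivative_eq_intros DERIV_chain2[OF v_deriv])
    show "((\<lambda>x. g (z - x) - g (z + x) - 4 * A t * x) has_real_derivative - 2 * d - 4 * A t) (at 0)"
    proof -
      have "((\<lambda>x. g (z - x)) has_real_derivative d * (0 - 1)) (at 0)"
        "((\<lambda>x. g (z + x)) has_real_derivative d * (0 + 1)) (at 0)"
        by (rule DERIV_chain2[where f = g]; auto intro!: derivative_eq_intros simp: d)+
      then show ?thesis
        by (auto intro!: derivative_eq_intros)
    qed
    show "q x \<le> q 0" for x
      using v_second_difference_bound[of t x z] t by (simp add: q_def)
  qed simp
  then show ?thesis
    using d by (intro exI[of _ d]) simp
qed

lemma gradient_slope:
  assumes "x \<le> y"
  shows "g x + 2 * A t * x \<le> g y + 2 * A t * y"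
proof (rule DERIV_nonneg_imp_nondecreasing[OF assms])
  fix z
  obtain d where "d \<ge> - 2 * A t" "(g has_real_derivative d) (at z)"
    using gradient_deriv_ge by blast
  then have "((\<lambda>x. g x + 2 * A t * x) has_real_derivative d + 2 * A t) (at z)" "d + 2 * A t \<ge> 0"
    by (auto intro!: derivative_eq_intros)
  then show "\<exists>D. ((\<lambda>x. g x + 2 * A t * x) has_real_derivative D) (at z) \<and> 0 \<le> D"
    by blast
qed

text \<open>Because \<open>\<gamma> t - 2 * A t = \<gamma> T\<close>, the function \<open>G\<close>
  has slope at least \<open>\<gamma> T > 0\<close>, so it meets the level \<open>s\<close> at most
  once. Negativity of \<open>g\<close> pushes the crossing strictly beyond
  \<open>s / \<gamma> t\<close>.\<close>

lemma threshold_crossing: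
  assumes "s > 0"
  shows "\<exists>z0 > s / \<gamma> t. (\<forall>z < z0. g z + \<gamma> t * z < s) \<and> g z0 + \<gamma> t * z0 = s \<and>
    (\<forall>z > z0. g z + \<gamma> t * z > s)"
proof -
  define G where "G = (\<lambda>z. g z + \<gamma> t * z)"
  have \<gamma>: "\<gamma> T > 0" "\<gamma> t > 0" "\<gamma> T < \<gamma> t"
    using \<gamma>_pos[of T] \<gamma>_pos[of t] \<gamma>_decreasing[of t T] t T_pos by auto
  have G_slope: "G x + \<gamma> T * (y - x) \<le> G y" if "x \<le> y" for x y
    using gradient_slope[OF that] by (simp add: G_def A_def field_simps)
  have G_mono: "G x < G y" if "x < y" for x y
  proof -
    have "\<gamma> T * (y - x) > 0"
      using \<gamma> that by simp
    then show ?thesis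
      using G_slope[of x y] that by linarith
  qed
  have lt: "s / \<gamma> t < s / \<gamma> T"
    using \<gamma> assms by (intro divide_strict_left_mono) auto
  have low: "G (s / \<gamma> t) < s"
    using gradient_neg[of "s / \<gamma> t"] \<gamma> assms by (simp add: G_def)
  \<comment> \<open>Oddness gives \<open>G 0 = 0\<close>, and a slope of at least
    \<open>\<gamma> T\<close> reaches the level \<open>s\<close> by this point.\<close>
  have "G (s / \<gamma> T) \<ge> s"
    using G_slope[of 0 "s / \<gamma> T"] gradient_odd[of 0] \<gamma> assms by (simp add: G_def)
  moreover have "continuous_on {s / \<gamma> t..s / \<gamma> T} G"
    unfolding G_def using gradient_deriv_ge
    by (intro continuous_intros continuous_at_imp_continuous_on) (metis DERIV_isCont)
  ultimately obtain z0 where z0: "s / \<gamma> t \<le> z0" "G z0 = s"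
    using IVT'[of G "s / \<gamma> t" s "s / \<gamma> T"] low lt by auto
  moreover have "z0 \<noteq> s / \<gamma> t"
    using z0(2) low by auto
  ultimately show ?thesis
    using G_mono[of _ z0] G_mono[of z0] by (intro exI[of _ z0]) (auto simp: G_def)
qed

end

end

section \<open>Reduction to the heat equation\<close>

lemma post_var_pos: "\<sigma>0 > 0 \<Longrightarrow> s \<ge> 0 \<Longrightarrow> post_var \<sigma> \<sigma>0 s > 0"
  unfolding post_var_def by (auto intro!: divide_pos_pos add_pos_nonneg)

lemma post_var_strict_antimono:
  assumes "\<sigma> > 0" "\<sigma>0 > 0" "0 \<le> s" "s < s'"
  shows "post_var \<sigma> \<sigma>0 s' < post_var \<sigma> \<sigma>0 s"
  unfolding post_var_def using assms
  by (intro divide_strict_left_mono add_strict_left_mono divide_strict_right_mono mult_pos_pos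
      add_pos_nonneg) auto

lemma post_var_deriv:
  assumes "\<sigma> > 0" "\<sigma>0 > 0" "s \<ge> 0"
  shows "(post_var \<sigma> \<sigma>0 has_real_derivative - (post_var \<sigma> \<sigma>0 s)\<^sup>2 / \<sigma>\<^sup>2) (at s within X)"
proof -
  have "1 / \<sigma>0\<^sup>2 + s / \<sigma>\<^sup>2 \<noteq> 0"
    using assms by (metis add_pos_nonneg divide_nonneg_nonneg less_numeral_extra(3) zero_le_power2
        zero_less_divide_1_iff zero_less_power)
  then show ?thesis
    unfolding post_var_def[abs_def]
    using assms by (auto intro!: derivative_eq_intros simp: power2_eq_square)
qed

section \<open>Differentiation of \<open>C12\<close> functions along curves\<close>

lemma C12_derivs:
  assumes "C12 T f" "s \<in> {0..<T}"
  shows "((\<lambda>s. f s y) has_real_derivative D_t T f s y) (at s within {0..<T})"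
    and "(f s has_real_derivative D_y f s y) (at y)"
    and "(D_y f s has_real_derivative D_y (D_y f) s y) (at y)"
proof -
  have d: "(\<lambda>s. f s y) differentiable (at s within {0..<T})" "f s differentiable (at y)"
    "D_y f s differentiable (at y)"
    using assms unfolding C12_def by auto
  show "((\<lambda>s. f s y) has_real_derivative D_t T f s y) (at s within {0..<T})"
    using d(1) by (simp add: D_t_def has_real_derivative_iff_has_vector_derivative vector_derivative_works)
  show "(f s has_real_derivative D_y f s y) (at y)"
    using d(2) by (simp add: D_y_def DERIV_deriv_iff_real_differentiable)
  show "(D_y f s has_real_derivative D_y (D_y f) s y) (at y)"
    using d(3) unfolding D_y_def[of "D_y f"] by (simp add: DERIV_deriv_iff_real_differentiable)
qed

text \<open>Continuity of \<open>D_y f\<close> upgrades the partial derivatives to joint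
  differentiability, after which the chain rule applies to the curve
  \<open>s \<mapsto> (s, h s)\<close>. The \<open>blinfun\<close> form is the one in which
  \<open>has_derivative_partialsI\<close> takes the derivative in the second variable.\<close>

lemma C12_deriv_along_curve:
  assumes "C12 T f" "s \<in> {0..<T}" "(h has_real_derivative h') (at s within {0..<T})"
  shows "((\<lambda>s. f s (h s)) has_real_derivative D_t T f s (h s) + D_y f s (h s) * h') (at s within {0..<T})"
proof -
  have "((\<lambda>(x, y). f x y) has_derivative
      (\<lambda>(tx, ty). D_t T f s (h s) * tx + blinfun_mult_right (D_y f s (h s)) ty))
      (at (s, h s) within {0..<T} \<times> UNIV)"
  proof (rule has_derivative_partialsI)
    show "((\<lambda>x. f x (h s)) has_derivative (\<lambda>tx. D_t T f s (h s) * tx)) (at s within {0..<T})"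
      using C12_derivs(1)[OF assms(1,2)] by (simp add: has_field_derivative_def)
    show "(f x has_derivative blinfun_apply (blinfun_mult_right (D_y f x y))) (at y within UNIV)"
      if "x \<in> {0..<T}" for x y
      using C12_derivs(2)[OF assms(1) that] by (simp add: has_field_derivative_def blinfun_mult_right.rep_eq)
    have "continuous (at (s, h s) within {0..<T} \<times> UNIV) (\<lambda>(x, y). D_y f x y)"
      using assms(1,2) by (auto simp: C12_def continuous_on_eq_continuous_within)
    then show "continuous (at (s, h s) within {0..<T} \<times> UNIV) (\<lambda>(x, y). blinfun_mult_right (D_y f x y))"
      unfolding case_prod_beta
      by (rule bounded_linear.continuous[OF bounded_linear_blinfun_mult_right])
  qed auto
  then have "((\<lambda>(x, y). f x y) has_derivative
      (\<lambda>(tx, ty). D_t T f s (h s) * tx + D_y f s (h s) * ty))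
      (at (s, h s) within (\<lambda>s. (s, h s)) ` {0..<T})"
    by (auto simp: blinfun_mult_right.rep_eq elim: has_derivative_subset)
  moreover have "((\<lambda>s. (s, h s)) has_derivative (\<lambda>x. (x, h' * x))) (at s within {0..<T})"
    using assms(3) unfolding has_field_derivative_def by (intro derivative_intros)
  ultimately have "((\<lambda>s. f s (h s)) has_derivative (\<lambda>x. D_t T f s (h s) * x + D_y f s (h s) * (h' * x)))
      (at s within {0..<T})"
    using has_derivative_in_compose by fastforce
  then show ?thesis
    unfolding has_field_derivative_def by (rule has_derivative_eq_rhs) (auto simp: algebra_simps)
qed

lemma pde_source_eq:
  assumes "\<gamma> > 0" "a > 0"
  shows "(- (\<gamma> * z) + a * sqrt \<gamma>)\<^sup>2 / (2 * \<sigma>\<^sup>2) * of_bool (- (\<gamma> * z) + a * sqrt \<gamma> \<le> 0)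
      + (- (\<gamma> * z) - a * sqrt \<gamma>)\<^sup>2 / (2 * \<sigma>\<^sup>2) * of_bool (- (\<gamma> * z) - a * sqrt \<gamma> \<ge> 0)
    = 1 / (2 * \<sigma>\<^sup>2) * \<gamma>\<^sup>2 * sq_excess (a / sqrt \<gamma>) z"
proof -
  define b where "b = a / sqrt \<gamma>"
  have b: "a * sqrt \<gamma> = \<gamma> * b" "b > 0"
    using assms \<open>a > 0\<close> by (auto simp: b_def field_simps)
  have 1: "- (\<gamma> * z) + \<gamma> * b \<le> 0 \<longleftrightarrow> b \<le> z" 
    using assms by simp
  have "- (\<gamma> * z) - \<gamma> * b = \<gamma> * (- z - b)"
    by (simp add: algebra_simps)
  then have 2: "- (\<gamma> * z) - \<gamma> * b \<ge> 0 \<longleftrightarrow> z \<le> - b"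
    using assms by (simp add: zero_le_mult_iff) linarith
  show ?thesis
    unfolding b 1 2 b_def[symmetric] using b(2)
    by (cases "b \<le> z"; cases "z \<le> - b")
      (auto simp: sq_excess_def max_def abs_if power2_eq_square algebra_simps add_divide_distrib diff_divide_distrib)
qed

text \<open>Along \<open>y = r + \<gamma> z\<close> with \<open>z\<close> fixed, \<open>y\<close>
  moves with velocity \<open>- \<gamma>\<^sup>2 z / \<sigma>\<^sup>2\<close>, which is exactly the
  drift coefficient \<open>\<gamma> (r - y) / \<sigma>\<^sup>2\<close>. The drift is thus absorbed
  into the time derivative.\<close>

lemma pde_solution_heat_form:
  assumes "T > 0" "\<sigma> > 0" "\<sigma>0 > 0" "a > 0" and sol: "pde_solution T \<sigma> \<sigma>0 r a f"
  shows "\<exists>C. heat_form (1 / (2 * \<sigma>\<^sup>2)) T a C (post_var \<sigma> \<sigma>0) (\<lambda>s z. f s (r + post_var \<sigma> \<sigma>0 s * z))"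
proof -
  let ?\<gamma> = "post_var \<sigma> \<sigma>0"
  have C12: "C12 T f"
    using sol by (simp add: pde_solution_def)
  obtain C where C: "C > 0" "\<And>s y. s \<in> {0..T} \<Longrightarrow> \<bar>f s y\<bar> \<le> C * (1 + y\<^sup>2)"
    using sol unfolding pde_solution_def by blast
  have \<gamma>_le: "?\<gamma> s \<le> ?\<gamma> 0" if "s \<in> {0..T}" for s
    using post_var_strict_antimono[OF assms(2,3), of 0 s] that by (cases "s = 0") auto
  have \<gamma>_cont: "continuous_on {0..T} ?\<gamma>"
    using post_var_deriv[OF assms(2,3)] by (intro DERIV_continuous_on) auto
  show ?thesis
  \<comment> \<open>The growth constant comes from \<open>(r + \<gamma> z)\<^sup>2 \<le> 2 r\<^sup>2
    + 2 \<gamma>\<^sup>2 z\<^sup>2\<close> and from \<gamma> being largest at time zero.\<close>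
  proof (intro exI[of _ "C * (1 + 2 * r\<^sup>2 + 2 * (?\<gamma> 0)\<^sup>2)"] heat_form.intro)
    show "(?\<gamma> has_real_derivative - 2 * (1 / (2 * \<sigma>\<^sup>2)) * (?\<gamma> s)\<^sup>2) (at s within {0..<T})"
      if "s \<in> {0..<T}" for s
      using post_var_deriv[OF assms(2,3), of s "{0..<T}"] that by simp
    show "continuous_on ({0..T} \<times> UNIV) (\<lambda>(s, z). f s (r + ?\<gamma> s * z))"
      using sol unfolding pde_solution_def case_prod_beta
      by (intro continuous_on_compose2[where f = "\<lambda>p. (fst p, r + ?\<gamma> (fst p) * snd p)"
            and g = "\<lambda>p. f (fst p) (snd p)" and t = "{0..T} \<times> UNIV", simplified])
        (auto intro!: continuous_intros continuous_on_compose2[OF \<gamma>_cont])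
    show "\<bar>f s (r + ?\<gamma> s * z)\<bar> \<le> C * (1 + 2 * r\<^sup>2 + 2 * (?\<gamma> 0)\<^sup>2) * (1 + z\<^sup>2)"
      if s: "s \<in> {0..T}" for s z
    proof -
      have "(r + ?\<gamma> s * z)\<^sup>2 \<le> 2 * r\<^sup>2 + 2 * (?\<gamma> s)\<^sup>2 * z\<^sup>2"
        using zero_le_power2[of "r - ?\<gamma> s * z"] by (simp add: power2_eq_square algebra_simps)
      moreover have "(?\<gamma> s)\<^sup>2 * z\<^sup>2 \<le> (?\<gamma> 0)\<^sup>2 * z\<^sup>2"
        using \<gamma>_le[OF s] post_var_pos[OF assms(3), of s \<sigma>] s
        by (intro mult_right_mono power_mono) auto
      ultimately have "1 + (r + ?\<gamma> s * z)\<^sup>2 \<le> 1 + 2 * r\<^sup>2 + 2 * (?\<gamma> 0)\<^sup>2 * z\<^sup>2"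
        by simp
      also have "\<dots> \<le> (1 + 2 * r\<^sup>2 + 2 * (?\<gamma> 0)\<^sup>2) * (1 + z\<^sup>2)"
        by (simp add: algebra_simps)
      finally show ?thesis
        using C(2)[OF s, of "r + ?\<gamma> s * z"] C(1) mult_left_mono[of _ _ C]
        by (fastforce simp: mult.assoc intro: order_trans)
    qed
    show "has_heat_op (1 / (2 * \<sigma>\<^sup>2)) {0..<T} (\<lambda>s z. f s (r + ?\<gamma> s * z)) s z
        (1 / (2 * \<sigma>\<^sup>2) * (?\<gamma> s)\<^sup>2 * sq_excess (a / sqrt (?\<gamma> s)) z)" if s: "s \<in> {0..<T}" for s z
    proof (rule has_heat_opI[where w' = "\<lambda>x. D_y f s (r + ?\<gamma> s * x) * ?\<gamma> s"])
      let ?y = "r + ?\<gamma> s * z"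
      show "((\<lambda>s. f s (r + ?\<gamma> s * z)) has_real_derivative
          D_t T f s ?y + D_y f s ?y * (- (?\<gamma> s)\<^sup>2 / \<sigma>\<^sup>2 * z)) (at s within {0..<T})"
        using s by (intro C12_deriv_along_curve[OF C12 s, where h = "\<lambda>s. r + ?\<gamma> s * z"])
          (auto intro!: derivative_eq_intros post_var_deriv assms)
      show "((\<lambda>x. f s (r + ?\<gamma> s * x)) has_real_derivative D_y f s (r + ?\<gamma> s * x) * ?\<gamma> s) (at x)" for x
        by (rule DERIV_chain2[OF C12_derivs(2)[OF C12 s]]) (auto intro!: derivative_eq_intros)
      show "((\<lambda>x. D_y f s (r + ?\<gamma> s * x) * ?\<gamma> s) has_real_derivative
          D_y (D_y f) s ?y * ?\<gamma> s * ?\<gamma> s) (at z)"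
        by (rule DERIV_cmult_right, rule DERIV_chain2[OF C12_derivs(3)[OF C12 s]])
          (auto intro!: derivative_eq_intros)
      have "r - ?y = - (?\<gamma> s * z)" by simp
      then have "D_t T f s ?y + 1 / 2 * D_y (D_y f) s ?y * ((?\<gamma> s)\<^sup>2 / \<sigma>\<^sup>2)
          + D_y f s ?y * (?\<gamma> s * - (?\<gamma> s * z) / \<sigma>\<^sup>2)
          - 1 / (2 * \<sigma>\<^sup>2) * (?\<gamma> s)\<^sup>2 * sq_excess (a / sqrt (?\<gamma> s)) z = 0"
        using sol s pde_source_eq[OF post_var_pos[OF assms(3)] \<open>a > 0\<close>, of s \<sigma> z \<sigma>]
        unfolding pde_solution_def Let_def by (metis atLeastLessThan_iff)
      then show "D_t T f s ?y + D_y f s ?y * (- (?\<gamma> s)\<^sup>2 / \<sigma>\<^sup>2 * z)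
          + 1 / (2 * \<sigma>\<^sup>2) * (D_y (D_y f) s ?y * ?\<gamma> s * ?\<gamma> s)
          = 1 / (2 * \<sigma>\<^sup>2) * (?\<gamma> s)\<^sup>2 * sq_excess (a / sqrt (?\<gamma> s)) z"
        by (simp add: power2_eq_square algebra_simps)
    qed
  qed (use assms \<gamma>_cont sol post_var_pos[OF assms(3)] post_var_strict_antimono[OF assms(2,3)]
      in \<open>auto simp: pde_solution_def\<close>)
qed

section \<open>The sign pattern of the feedback\<close>

theorem corollary3p5:
  fixes T \<sigma> \<sigma>0 k r a t :: real and f :: "real \<Rightarrow> real \<Rightarrow> real"
  assumes "T > 0" and "\<sigma> > 0" and "\<sigma>0 > 0" and "k > 0" and "a > 0"
    and "0 \<le> t" and "t < T"
    and "pde_solution T \<sigma> \<sigma>0 r a f"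
  shows "\<exists>y1 y2.
    y1 < r - a * sqrt (post_var \<sigma> \<sigma>0 t) \<and>
    y2 > r + a * sqrt (post_var \<sigma> \<sigma>0 t) \<and>
    (\<forall>y. y < y1 \<longrightarrow> robust_feedback T \<sigma> \<sigma>0 k r a f t y < 0) \<and>
    (\<forall>y. y1 < y \<and> y < r \<longrightarrow> robust_feedback T \<sigma> \<sigma>0 k r a f t y > 0) \<and>
    (\<forall>y. r < y \<and> y < y2 \<longrightarrow> robust_feedback T \<sigma> \<sigma>0 k r a f t y < 0) \<and>
    (\<forall>y. y > y2 \<longrightarrow> robust_feedback T \<sigma> \<sigma>0 k r a f t y > 0) \<and>
    (\<forall>y\<in>{y1, r, y2}. robust_feedback T \<sigma> \<sigma>0 k r a f t y = 0)"
proof -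
  define \<gamma> where "\<gamma> = post_var \<sigma> \<sigma>0 t"
  define s where "s = a * sqrt \<gamma>"
  define g where "g = (\<lambda>z. D_y f t (r + \<gamma> * z) * \<gamma>)"
  have "\<gamma> > 0"
    using post_var_pos assms by (simp add: \<gamma>_def)
  then have "s > 0"
    using \<open>a > 0\<close> by (simp add: s_def)
  obtain C where
    "heat_form (1 / (2 * \<sigma>\<^sup>2)) T a C (post_var \<sigma> \<sigma>0) (\<lambda>s z. f s (r + post_var \<sigma> \<sigma>0 s * z))"
    using pde_solution_heat_form assms by blast
  then interpret heat_form "1 / (2 * \<sigma>\<^sup>2)" T a C "post_var \<sigma> \<sigma>0" "\<lambda>s z. f s (r + post_var \<sigma> \<sigma>0 s * z)" .
  have t: "t \<in> {0..<T}"
    using assms by simp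
  have C12: "C12 T f"
    using assms by (simp add: pde_solution_def)
  have g: "((\<lambda>z. f t (r + post_var \<sigma> \<sigma>0 t * z)) has_real_derivative g z) (at z)" for z
    unfolding g_def \<gamma>_def
    by (rule DERIV_chain2[OF C12_derivs(2)[OF C12 t]]) (auto intro!: derivative_eq_intros)
  note odd = gradient_odd[OF t g] and neg = gradient_neg[OF t g]
  obtain z0 where z0: "z0 > s / \<gamma>" "g z0 + \<gamma> * z0 = s"
    and below: "\<And>z. z < z0 \<Longrightarrow> g z + \<gamma> * z < s" and above: "\<And>z. z > z0 \<Longrightarrow> g z + \<gamma> * z > s"
    using threshold_crossing[OF t g \<open>s > 0\<close>] unfolding \<gamma>_def[symmetric] by blast
  \<comment> \<open>The crossing lies in the outer region, where \<open>\<Phi>\<close> is given by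
    its first branch and therefore vanishes at \<open>z0\<close>.\<close>
  have "\<gamma> * z0 > s"
    using z0(1) \<open>\<gamma> > 0\<close> by (simp add: field_simps)
  have "z0 > 0"
    using z0(1) \<open>\<gamma> > 0\<close> \<open>s > 0\<close> by (meson divide_pos_pos less_trans)
  define K where "K = exp (- r * (T - t)) / (k * \<sigma>\<^sup>2)"
  \<comment> \<open>The last branch is \<open>g z + \<gamma> * z + s\<close>, rewritten by oddness
    of \<open>g\<close> as minus the first branch at \<open>- z\<close>. This makes
    \<open>\<Phi>\<close> visibly odd, so its signs are needed only for
    \<open>z > 0\<close>.\<close>
  define \<Phi> where "\<Phi> = (\<lambda>z. if s < \<gamma> * z then g z + \<gamma> * z - s
      else if - s \<le> \<gamma> * z then g z else - (g (- z) + \<gamma> * (- z) - s))"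
  have "K > 0"
    using assms by (simp add: K_def)
  have feedback: "robust_feedback T \<sigma> \<sigma>0 k r a f t y = K * \<Phi> ((y - r) / \<gamma>)" for y
  proof -
    have "\<gamma> * ((y - r) / \<gamma>) = y - r"
      using \<open>\<gamma> > 0\<close> by simp
    then show ?thesis
      unfolding robust_feedback_def Let_def \<Phi>_def odd K_def[symmetric] \<gamma>_def[symmetric] s_def[symmetric]
      by (auto simp: g_def)
  qed
  have \<Phi>_odd: "\<Phi> (- z) = - \<Phi> z" for z
    using odd[of z] \<open>s > 0\<close> by (auto simp: \<Phi>_def)
  \<comment> \<open>Inside the threshold the sign is that of \<open>g\<close>; between the threshold
    and \<open>z0\<close> it comes from lying below the crossing.\<close>
  have \<Phi>_neg: "\<Phi> z < 0" if "0 < z" "z < z0" for z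
    using neg[OF that(1)] below[OF that(2)] mult_pos_pos[OF \<open>\<gamma> > 0\<close> that(1)] \<open>s > 0\<close>
    by (auto simp: \<Phi>_def)
  have \<Phi>_pos: "\<Phi> z > 0" if "z > z0" for z
    using above[OF that] mult_strict_left_mono[OF that \<open>\<gamma> > 0\<close>] \<open>\<gamma> * z0 > s\<close> by (simp add: \<Phi>_def)
  have \<Phi>_z0: "\<Phi> z0 = 0" and \<Phi>_0: "\<Phi> 0 = 0"
    using z0(2) \<open>\<gamma> * z0 > s\<close> \<Phi>_odd[of 0] by (auto simp: \<Phi>_def)
  show ?thesis
    unfolding feedback \<gamma>_def[symmetric] s_def[symmetric]
  proof (rule exI[of _ "r - \<gamma> * z0"], rule exI[of _ "r + \<gamma> * z0"], intro conjI allI impI ballI)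
    fix y
    let ?z = "(y - r) / \<gamma>"
    show "K * \<Phi> ?z < 0" if "y < r - \<gamma> * z0"
    proof -
      have "- ?z > z0" using that \<open>\<gamma> > 0\<close> by (simp add: field_simps)
      then show ?thesis using \<Phi>_pos[of "- ?z"] \<open>K > 0\<close> \<Phi>_odd by (simp add: mult_pos_neg)
    qed
    show "K * \<Phi> ?z > 0" if "r - \<gamma> * z0 < y \<and> y < r"
    proof -
      have "0 < - ?z" "- ?z < z0" using that \<open>\<gamma> > 0\<close> by (simp_all add: field_simps)
      then show ?thesis using \<Phi>_neg[of "- ?z"] \<open>K > 0\<close> \<Phi>_odd by simp
    qed
    show "K * \<Phi> ?z < 0" if "r < y \<and> y < r + \<gamma> * z0"
    proof -
      have "0 < ?z" "?z < z0" using that \<open>\<gamma> > 0\<close> by (simp_all add: field_simps)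
      then show ?thesis using \<Phi>_neg[of ?z] \<open>K > 0\<close> by (simp add: mult_pos_neg)
    qed
    show "K * \<Phi> ?z > 0" if "r + \<gamma> * z0 < y"
    proof -
      have "?z > z0" using that \<open>\<gamma> > 0\<close> by (simp add: field_simps)
      then show ?thesis using \<Phi>_pos[of ?z] \<open>K > 0\<close> by simp
    qed
    show "K * \<Phi> ?z = 0" if "y \<in> {r - \<gamma> * z0, r, r + \<gamma> * z0}"
      using that \<open>\<gamma> > 0\<close> \<Phi>_z0 \<Phi>_0 \<Phi>_odd[of z0] by auto
  qed (use \<open>\<gamma> * z0 > s\<close> in auto)
qed

end
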